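(* For every integer $t\ge 5$, $$R^{\mathrm{KG}}_2(3,t)\le 2R(3,t-2)+2t+1.$$
   Context: $R(a,b)$ is the classical Ramsey number: the least $n$ such that every red/blue edge-coloring of $K_n$ contains a red $K_a$ or a blue $K_b$. The Kneser graph $\mathrm{KG}(n,r)$ has vertex set the $r$-element subsets of $[n]=\{1,\dots,n\}$, with two sets adjacent iff they are disjoint. The $r$-Kneser Ramsey number $R^{\mathrm{KG}}_r(a,b)$ is the minimum integer $n$ such that every red/blue edge-coloring of $\mathrm{KG}(n,r)$ contains a red $K_a$ (a set of $a$ pairwise adjacent vertices with all connecting edges red) or a blue $K_b$. *)

theory Defs
  imports "HOL-Library.Ramsey"
begin

text \<open>
  A simple graph is a vertex set \<open>V\<close> together with a set \<open>E\<close> of two-element subsets of \<open>V\<close>.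
  A red/blue edge-colouring is a partition of \<open>E\<close> into two (possibly empty) colour classes.
  \<open>ramsey_arrows V E a b\<close> says that every colouring yields a red \<open>K\<^sub>a\<close> or a blue \<open>K\<^sub>b\<close>; as the
  colour classes are sets of edges, the vertices of such a clique are pairwise adjacent.
\<close>

definition ramsey_arrows :: "'a set \<Rightarrow> 'a set set \<Rightarrow> nat \<Rightarrow> nat \<Rightarrow> bool" where
  "ramsey_arrows V E a b \<longleftrightarrow>
    (\<forall>red blue. red \<union> blue = E \<and> red \<inter> blue = {} \<longrightarrow>
      (\<exists>S \<in> nsets V a. clique S red) \<or> (\<exists>S \<in> nsets V b. clique S blue))"

definition ramsey_number :: "nat \<Rightarrow> nat \<Rightarrow> nat" where
  "ramsey_number a b = (LEAST n. ramsey_arrows {1..n} (nsets {1..n} 2) a b)"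

definition kneser_vertices :: "nat \<Rightarrow> nat \<Rightarrow> nat set set" where
  "kneser_vertices n r = nsets {1..n} r"

text \<open>The condition \<open>A \<noteq> B\<close> matters only for \<open>r = 0\<close>, where it excludes a loop.\<close>

definition kneser_edges :: "nat \<Rightarrow> nat \<Rightarrow> nat set set set" where
  "kneser_edges n r =
    {{A, B} | A B. A \<in> kneser_vertices n r \<and> B \<in> kneser_vertices n r \<and> A \<noteq> B \<and> A \<inter> B = {}}"

definition kneser_ramsey_number :: "nat \<Rightarrow> nat \<Rightarrow> nat \<Rightarrow> nat" where
  "kneser_ramsey_number r a b =
    (LEAST n. ramsey_arrows (kneser_vertices n r) (kneser_edges n r) a b)"

text \<open>
  Both minima are attained (the second one for \<open>r \<ge> 1\<close>), so that \<^const>\<open>Least\<close> is meaningful.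
\<close>

lemma ramsey_number_arrows:
  "ramsey_arrows {1..ramsey_number a b} (nsets {1..ramsey_number a b} 2) a b"
proof -
  obtain N where N: "\<And>(V :: nat set) E. finite V \<Longrightarrow> card V \<ge> N \<Longrightarrow>
      \<exists>R \<subseteq> V. card R = a \<and> clique R E \<or> card R = b \<and> indep R E"
    using ramsey2[of a b] by blast
  have "ramsey_arrows {1..N} (nsets {1..N} 2) a b"
    unfolding ramsey_arrows_def
  proof (intro allI impI)
    fix red blue :: "nat set set"
    assume col: "red \<union> blue = nsets {1..N} 2 \<and> red \<inter> blue = {}"
    obtain R where R: "R \<subseteq> {1..N}"
      and or: "card R = a \<and> clique R red \<or> card R = b \<and> indep R red"
      using N[of "{1..N}" red] by auto
    have fin: "finite R"
      using R finite_subset by blast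
    have "clique R blue" if "indep R red"
      unfolding clique_def
    proof (intro ballI impI)
      fix v w assume vw: "v \<in> R" "w \<in> R" "v \<noteq> w"
      then have "{v, w} \<in> nsets {1..N} 2"
        using R by (auto simp del: atLeastAtMost_iff)
      then show "{v, w} \<in> blue"
        using that vw col unfolding indep_def by blast
    qed
    then show "(\<exists>S \<in> nsets {1..N} a. clique S red) \<or> (\<exists>S \<in> nsets {1..N} b. clique S blue)"
      using or R fin unfolding nsets_def by blast
  qed
  then show ?thesis
    unfolding ramsey_number_def by (rule LeastI)
qed

lemma kneser_ramsey_number_arrows:
  fixes r a b :: nat
  assumes "r \<ge> 1"
  defines "n \<equiv> kneser_ramsey_number r a b"
  shows "ramsey_arrows (kneser_vertices n r) (kneser_edges n r) a b"
proof -
  obtain N where N: "\<And>(V :: nat set) E. finite V \<Longrightarrow> card V \<ge> N \<Longrightarrow>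
      \<exists>R \<subseteq> V. card R = a \<and> clique R E \<or> card R = b \<and> indep R E"
    using ramsey2[of a b] by blast
  define A where "A i = {i * r + 1..i * r + r}" for i :: nat
  have A_vertex: "A i \<in> kneser_vertices (N * r) r" if "i < N" for i
  proof -
    have "i * r + r \<le> N * r"
      using that mult_le_mono1[of "Suc i" N r] by simp
    then show ?thesis
      by (auto simp: A_def kneser_vertices_def nsets_def)
  qed
  have A_disj_less: "A i \<inter> A j = {}" if "i < j" for i j
  proof -
    have "i * r + r \<le> j * r"
      using that mult_le_mono1[of "Suc i" j r] by simp
    then show ?thesis
      by (auto simp: A_def)
  qed
  have A_disj: "A i \<inter> A j = {}" if "i \<noteq> j" for i j
    using A_disj_less[of i j] A_disj_less[of j i] that by (metis Int_commute linorder_neqE_nat)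
  have A_ne: "A i \<noteq> {}" for i
    using assms(1) by (simp add: A_def)
  have inj: "inj A"
    using A_disj A_ne by (metis inf.idem injI)
  have "ramsey_arrows (kneser_vertices (N * r) r) (kneser_edges (N * r) r) a b"
    unfolding ramsey_arrows_def
  proof (intro allI impI)
    fix red blue
    assume col: "red \<union> blue = kneser_edges (N * r) r \<and> red \<inter> blue = {}"
    define E where "E = {{i, j} | i j. {A i, A j} \<in> red}"
    have E_iff: "{i, j} \<in> E \<longleftrightarrow> {A i, A j} \<in> red" for i j
      unfolding E_def by (auto simp: doubleton_eq_iff insert_commute)
    obtain R where R: "R \<subseteq> {..<N}"
      and or: "card R = a \<and> clique R E \<or> card R = b \<and> indep R E"
      using N[of "{..<N}" E] by auto
    have fin: "finite (A ` R)"
      using R finite_subset by blast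
    have card: "card (A ` R) = card R"
      using inj by (meson card_image inj_on_subset subset_UNIV)
    have sub: "A ` R \<subseteq> kneser_vertices (N * r) r"
      using R A_vertex by auto
    have red: "clique (A ` R) red" if "clique R E"
      unfolding clique_def
    proof (intro ballI impI)
      fix v w assume "v \<in> A ` R" "w \<in> A ` R" "v \<noteq> w"
      then obtain i j where ij: "i \<in> R" "j \<in> R" "i \<noteq> j" "v = A i" "w = A j"
        by blast
      then have "{i, j} \<in> E"
        using that by (simp add: clique_def)
      then show "{v, w} \<in> red"
        by (simp add: E_iff ij)
    qed
    have blue: "clique (A ` R) blue" if "indep R E"
      unfolding clique_def
    proof (intro ballI impI)
      fix v w assume "v \<in> A ` R" "w \<in> A ` R" "v \<noteq> w"
      then obtain i j where ij: "i \<in> R" "j \<in> R" "i \<noteq> j" "v = A i" "w = A j"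
        by blast
      have "v \<in> kneser_vertices (N * r) r" "w \<in> kneser_vertices (N * r) r" "v \<inter> w = {}"
        using sub A_disj[of i j] ij by auto
      then have "{v, w} \<in> kneser_edges (N * r) r"
        using \<open>v \<noteq> w\<close> unfolding kneser_edges_def by blast
      moreover have "{i, j} \<notin> E"
        using that ij by (simp add: indep_def)
      then have "{v, w} \<notin> red"
        by (simp add: E_iff ij)
      ultimately show "{v, w} \<in> blue"
        using col by blast
    qed
    show "(\<exists>S \<in> nsets (kneser_vertices (N * r) r) a. clique S red) \<or>
        (\<exists>S \<in> nsets (kneser_vertices (N * r) r) b. clique S blue)"
      using or
    proof
      assume "card R = a \<and> clique R E"
      then have "A ` R \<in> nsets (kneser_vertices (N * r) r) a" "clique (A ` R) red"
        using red fin card sub by (simp_all add: nsets_def)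
      then show ?thesis by blast
    next
      assume "card R = b \<and> indep R E"
      then have "A ` R \<in> nsets (kneser_vertices (N * r) r) b" "clique (A ` R) blue"
        using blue fin card sub by (simp_all add: nsets_def)
      then show ?thesis by blast
    qed
  qed
  then show ?thesis
    unfolding n_def kneser_ramsey_number_def by (rule LeastI)
qed

end

theory Submission
  imports Defs
begin

text \<open>
  Let \<open>N = R(3, t - 2)\<close> and suppose that a colouring of \<open>KG(2N + 2t + 1, 2)\<close> has no red
  \<open>K\<^sub>3\<close> and no blue \<open>K\<^sub>t\<close>. Fix a blue pair of disjoint edges \<open>A, B\<close> of the complete graph on
  the ground set, and sort the edges on the remaining \<open>2N + 2t - 3\<close> points into those red to
  \<open>A\<close>, those blue to \<open>A\<close> and red to \<open>B\<close>, and those blue to both. A matching in the first class is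
  a blue clique, so it has at most \<open>t - 1\<close> edges; a matching in the second class is a blue clique
  that can be extended by \<open>A\<close>, so it has at most \<open>t - 2\<close> edges. By the Cockayne--Lorimer theorem
  the third class contains a matching with \<open>N\<close> edges (this needs \<open>N \<ge> t\<close>), hence a blue
  clique of size \<open>t - 2\<close>, which \<open>A\<close> and \<open>B\<close> extend to a blue \<open>K\<^sub>t\<close>.

  The Cockayne--Lorimer theorem is reduced, by deleting vertices that lie in all maximum matchings
  of some colour, to the situation where no colour has such a vertex. Then, as in Gallai's lemma,
  the relation ``no maximum matching of the colour misses both \<open>x\<close> and \<open>y\<close>'' is transitive, which
  leaves too few edges in the colours together.
\<close>

section \<open>Matchings and the exchange of two maximum matchings\<close>

text \<open>The host graph stays outside the notion and enters as \<open>M \<subseteq> E\<close>.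
  Finiteness is demanded because \<open>card\<close> is 0 on infinite sets. The edges of a matching
  on [n] are pairwise adjacent vertices of KG(n,2).\<close>

definition matching :: "'a set set \<Rightarrow> bool" where
  "matching M \<longleftrightarrow> finite M \<and> (\<forall>e\<in>M. card e = 2) \<and> pairwise disjnt M"

lemma matching_empty: "matching {}"
  by (simp add: matching_def)

lemma matching_subset: "matching M \<Longrightarrow> M' \<subseteq> M \<Longrightarrow> matching M'"
  unfolding matching_def by (meson finite_subset pairwise_subset subsetD)

lemma matching_insert:
  assumes "matching M" "card e = 2" "e \<inter> \<Union>M = {}"
  shows "matching (insert e M)" "card (insert e M) = Suc (card M)"
proof -
  have "e \<noteq> {}"
    using assms(2) by auto
  then have "e \<notin> M"
    using assms(3) by blast
  then show "card (insert e M) = Suc (card M)"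
    using assms(1) by (simp add: matching_def)
  show "matching (insert e M)"
    using assms unfolding matching_def pairwise_insert disjnt_def by blast
qed

lemma matching_remove:
  assumes "matching M" "e \<in> M"
  shows "matching (M - {e})" "Suc (card (M - {e})) = card M" "\<Union>(M - {e}) = \<Union>M - e"
proof -
  show "matching (M - {e})"
    using assms(1) by (rule matching_subset) blast
  show "Suc (card (M - {e})) = card M"
    using assms unfolding matching_def by (metis card_Suc_Diff1)
  show "\<Union>(M - {e}) = \<Union>M - e"
    using assms unfolding matching_def pairwise_def disjnt_def by blast
qed

lemma finite_Union_matching: "matching M \<Longrightarrow> finite (\<Union>M)"
  unfolding matching_def by (metis card.infinite finite_Union zero_neq_numeral)

lemma card_Union_matching:
  assumes "matching M"
  shows "card (\<Union>M) = 2 * card M"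
proof -
  have "card (\<Union>M) = sum card M"
    using assms unfolding matching_def
    by (intro card_Union_disjoint) (auto intro: card_ge_0_finite)
  also have "\<dots> = 2 * card M"
    using assms by (simp add: matching_def)
  finally show ?thesis .
qed

text \<open>
  The conclusion comes from switching \<open>M\<close> along the alternating path that starts in \<open>v\<close>, which can
  end in at most one of \<open>u\<close> and \<open>w\<close>. The induction peels off the first two edges of this path.
\<close>

lemma matching_exchange:
  assumes "matching M" "matching N" "card M = card N"
    and "v \<notin> \<Union>N" "u \<notin> \<Union>M" "w \<notin> \<Union>M" "u \<noteq> w"
    and "\<And>K. K \<subseteq> M \<union> N \<Longrightarrow> matching K \<Longrightarrow> card K \<le> card M"
  shows "\<exists>M' \<subseteq> M \<union> N. matching M' \<and> card M' = card M \<and> v \<notin> \<Union>M' \<and> (u \<notin> \<Union>M' \<or> w \<notin> \<Union>M')"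
  using assms
proof (induction "card M" arbitrary: M N v)
  case 0
  then have "M = {}"
    by (simp add: matching_def)
  then show ?case
    using matching_empty by auto
next
  case (Suc n)
  show ?case
  proof (cases "v \<in> \<Union>M")
    case False
    then show ?thesis
      using Suc.prems by blast
  next
    case True
    then obtain e where e: "e \<in> M" "v \<in> e"
      by blast
    then have "card e = 2"
      using Suc.prems(1) by (simp add: matching_def)
    then obtain a where a: "e = {v, a}" "a \<noteq> v"
      using e by (auto simp: card_2_iff)
    \<comment> \<open>Otherwise \<open>e\<close> could be added to \<open>N\<close>, giving a
      matching in \<open>M \<union> N\<close> larger than \<open>M\<close>.\<close>
    have "a \<in> \<Union>N"
    proof (rule ccontr)
      assume "a \<notin> \<Union>N"
      then have "e \<inter> \<Union>N = {}"
        using a Suc.prems(4) by blast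
      then have "matching (insert e N)" "card (insert e N) = Suc (card N)"
        using matching_insert[OF Suc.prems(2) \<open>card e = 2\<close>] by blast+
      moreover have "insert e N \<subseteq> M \<union> N"
        using e by blast
      ultimately show False
        using Suc.prems(3) Suc.prems(8)[of "insert e N"] by simp
    qed
    then obtain f where f: "f \<in> N" "a \<in> f"
      by blast
    then have "card f = 2"
      using Suc.prems(2) by (simp add: matching_def)
    then obtain b where b: "f = {a, b}" "b \<noteq> a"
      using f by (auto simp: card_2_iff)
    have "b \<noteq> v"
      using b f Suc.prems(4) by blast
    define M0 where "M0 = M - {e}"
    define N0 where "N0 = N - {f}"
    note M0 = matching_remove[OF Suc.prems(1) e(1), folded M0_def]
    note N0 = matching_remove[OF Suc.prems(2) f(1), folded N0_def]
    have ua: "u \<noteq> a" "w \<noteq> a"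
      using Suc.prems(5,6) e a by blast+
    \<comment> \<open>\<open>M0\<close> and \<open>N0\<close> have lost all edges at
      \<open>v\<close> and \<open>a\<close>, so \<open>e\<close> can be added to every matching in
      \<open>M0 \<union> N0\<close>. This carries maximality over to \<open>M0\<close>.\<close>
    have va: "v \<notin> \<Union>K" "a \<notin> \<Union>K" if "K \<subseteq> M0 \<union> N0" for K
    proof -
      have "\<Union>K \<subseteq> (\<Union>M - e) \<union> (\<Union>N - f)"
        using Union_mono[OF that] M0(3) N0(3) by simp
      then show "v \<notin> \<Union>K" "a \<notin> \<Union>K"
        using a(1) b(1) Suc.prems(4) by blast+
    qed
    \<comment> \<open>The next path vertex \<open>b\<close> takes the role of \<open>v\<close>.
      Putting \<open>f\<close> back will cover \<open>b\<close>, so the surviving one of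
      \<open>u\<close> and \<open>w\<close> must also differ from \<open>b\<close>. If
      \<open>M\<close> misses \<open>b\<close>, the path ends there and, as
      \<open>u \<noteq> w\<close>, reaches at most one of them.\<close>
    have "\<exists>M1 \<subseteq> M0 \<union> N0. matching M1 \<and> card M1 = n \<and> b \<notin> \<Union>M1 \<and>
        (u \<notin> insert b (\<Union>M1) \<or> w \<notin> insert b (\<Union>M1))"
    proof (cases "b \<in> \<Union>M")
      case False
      then show ?thesis
        using M0 Suc.prems(5-7) Suc.hyps(2) by (intro exI[of _ M0]) auto
    next
      case True
      have "\<exists>M1 \<subseteq> M0 \<union> N0. matching M1 \<and> card M1 = card M0 \<and> b \<notin> \<Union>M1 \<and> (u \<notin> \<Union>M1 \<or> w \<notin> \<Union>M1)"
      proof (rule Suc.hyps(1)[OF _ M0(1) N0(1)])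
        show "n = card M0" "card M0 = card N0"
          using M0(2) N0(2) Suc.hyps(2) Suc.prems(3) by simp_all
        show "b \<notin> \<Union>N0" "u \<notin> \<Union>M0" "w \<notin> \<Union>M0" "u \<noteq> w"
          using N0(3) M0(3) b Suc.prems(5-7) by blast+
        fix K assume K: "K \<subseteq> M0 \<union> N0" "matching K"
        have "e \<inter> \<Union>K = {}"
          using va[OF K(1)] a by blast
        then have "matching (insert e K)" "card (insert e K) = Suc (card K)"
          using matching_insert[OF K(2) \<open>card e = 2\<close>] by blast+
        moreover have "insert e K \<subseteq> M \<union> N"
          using e K unfolding M0_def N0_def by blast
        ultimately have "Suc (card K) \<le> card M"
          using Suc.prems(8)[of "insert e K"] by simp
        then show "card K \<le> card M0"
          using M0(2) by simp
      qed
      moreover have "u \<noteq> b" "w \<noteq> b"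
        using True Suc.prems(5,6) by blast+
      moreover have "card M0 = n"
        using M0(2) Suc.hyps(2) by simp
      ultimately show ?thesis
        by auto
    qed
    then obtain M1 where M1: "M1 \<subseteq> M0 \<union> N0" "matching M1" "card M1 = n" "b \<notin> \<Union>M1"
        "u \<notin> insert b (\<Union>M1) \<or> w \<notin> insert b (\<Union>M1)"
      by blast
    have "f \<inter> \<Union>M1 = {}"
      using va[OF M1(1)] M1(4) b by blast
    then have "matching (insert f M1)" "card (insert f M1) = card M"
      using matching_insert[OF M1(2) \<open>card f = 2\<close>] M1(3) Suc.hyps(2) by simp_all
    moreover have "insert f M1 \<subseteq> M \<union> N"
      using f M1(1) unfolding M0_def N0_def by blast
    moreover have "v \<notin> \<Union>(insert f M1)"
      using va[OF M1(1)] b a(2) \<open>b \<noteq> v\<close> by auto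
    moreover have "u \<notin> \<Union>(insert f M1) \<or> w \<notin> \<Union>(insert f M1)"
      using M1(5) ua b by auto
    ultimately show ?thesis
      by blast
  qed
qed

section \<open>An edge count in the manner of Gallai's lemma\<close>

text \<open>Together with equality, \<open>rel\<close> is an equivalence relation on
  \<open>V\<close> that joins the ends of every edge. A fixed maximum matching covers 2k vertices
  and misses at most one vertex of each class. Counting ordered pairs inside the classes gives the
  bound, which the complete graph on 2k + 1 points attains.\<close>

lemma no_essential_vertex_edge_bound:
  fixes E :: "'a set set"
  assumes "finite V"
    and max: "\<And>M. M \<subseteq> E \<Longrightarrow> matching M \<Longrightarrow> card M \<le> k"
    and avoid: "\<And>x. x \<in> V \<Longrightarrow> \<exists>M \<subseteq> E. matching M \<and> card M = k \<and> x \<notin> \<Union>M"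
  shows "card {(x, y). x \<in> V \<and> y \<in> V \<and> x \<noteq> y \<and> {x, y} \<in> E} \<le> 2 * k * (2 * k + 1)"
proof (cases "V = {}")
  case True
  then show ?thesis by simp
next
  case False
  define rel where "rel x y \<longleftrightarrow> x \<noteq> y \<and>
    (\<forall>M \<subseteq> E. matching M \<longrightarrow> card M = k \<longrightarrow> x \<in> \<Union>M \<or> y \<in> \<Union>M)" for x y
  have edge_rel: "rel x y" if "x \<noteq> y" "{x, y} \<in> E" for x y
    unfolding rel_def
  proof (intro conjI allI impI)
    show "x \<noteq> y" by fact
    fix M assume M: "M \<subseteq> E" "matching M" "card M = k"
    show "x \<in> \<Union>M \<or> y \<in> \<Union>M"
    proof (rule ccontr)
      assume "\<not> ?thesis"
      then have "{x, y} \<inter> \<Union>M = {}" by blast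
      then have "matching (insert {x, y} M)" "card (insert {x, y} M) = Suc k"
        using matching_insert[OF M(2), of "{x, y}"] M(3) that(1) by simp_all
      then show False
        using max[of "insert {x, y} M"] M(1) that(2) by simp
    qed
  qed
  have rel_sym: "rel y x" if "rel x y" for x y
    using that unfolding rel_def by blast
  have rel_trans: "rel x z" if xyz: "rel x y" "rel y z" "x \<noteq> z" "y \<in> V" for x y z
    unfolding rel_def
  proof (intro conjI allI impI)
    show "x \<noteq> z" by fact
    fix M assume M: "M \<subseteq> E" "matching M" "card M = k"
    show "x \<in> \<Union>M \<or> z \<in> \<Union>M"
    proof (rule ccontr)
      assume "\<not> ?thesis"
      then have xz: "x \<notin> \<Union>M" "z \<notin> \<Union>M" by blast+
      \<comment> \<open>Exchanging \<open>M\<close> with an \<open>N\<close> that misses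
        \<open>y\<close> gives a maximum matching that misses \<open>y\<close> and one of
        \<open>x\<close>, \<open>z\<close>, against \<open>rel x y\<close> or
        \<open>rel y z\<close>.\<close>
      obtain N where N: "N \<subseteq> E" "matching N" "card N = k" "y \<notin> \<Union>N"
        using avoid[OF xyz(4)] by blast
      have "card K \<le> card M" if "K \<subseteq> M \<union> N" "matching K" for K
        using max[of K] that M N by blast
      then obtain M' where "M' \<subseteq> M \<union> N" "matching M'" "card M' = card M" "y \<notin> \<Union>M'"
          "x \<notin> \<Union>M' \<or> z \<notin> \<Union>M'"
        using matching_exchange[OF M(2) N(2) _ N(4) xz xyz(3)] M(3) N(3) by auto
      moreover have "M' \<subseteq> E"
        using calculation M N by blast
      ultimately show False
        using xyz M(3) unfolding rel_def by metis
    qed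
  qed
  obtain M where M: "M \<subseteq> E" "matching M" "card M = k"
    using False avoid by blast
  define U where "U = \<Union>M"
  have U: "finite U" "card U = 2 * k"
    using M finite_Union_matching card_Union_matching unfolding U_def by auto
  have hit: "x \<in> U \<or> y \<in> U" if "rel x y" for x y
    using that M unfolding rel_def U_def by blast
  define D where "D = {(x, y). x \<in> V \<and> y \<in> V \<and> rel x y}"
  define D1 where "D1 = (SIGMA x:U. {y \<in> V. x \<in> V \<and> rel x y})"
  define D2 where "D2 = {(x, y) \<in> D. x \<notin> U}"
  have "finite D"
    by (rule finite_subset[of _ "V \<times> V"]) (auto simp: D_def assms(1))
  \<comment> \<open>Two vertices outside \<open>U\<close> related to \<open>x\<close> would be
    related to each other, yet both missed by \<open>M\<close>. So at most one lies outside, and the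
    others are among the 2k - 1 elements of \<open>U - {x}\<close>.\<close>
  have "card {y \<in> V. x \<in> V \<and> rel x y} \<le> 2 * k" if "x \<in> U" for x
  proof (cases "\<exists>z. z \<in> V \<and> x \<in> V \<and> rel x z \<and> z \<notin> U")
    case False
    then have "{y \<in> V. x \<in> V \<and> rel x y} \<subseteq> U"
      by blast
    then show ?thesis
      using U card_mono by metis
  next
    case True
    then obtain z where z: "z \<in> V" "x \<in> V" "rel x z" "z \<notin> U"
      by blast
    have "y = z" if "y \<in> V" "rel x y" "y \<notin> U" for y
      using hit[of y z] rel_trans[of y x z] rel_sym that z by blast
    then have "{y \<in> V. x \<in> V \<and> rel x y} \<subseteq> insert z (U - {x})"
      unfolding rel_def by blast
    moreover have "card (insert z (U - {x})) = 2 * k"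
      using U that z(4) by (metis Diff_iff card.insert_remove card_Suc_Diff1 card_insert_disjoint finite_Diff)
    ultimately show ?thesis
      using U(1) by (metis card_mono finite_Diff finite_insert)
  qed
  then have "(\<Sum>x\<in>U. card {y \<in> V. x \<in> V \<and> rel x y}) \<le> (\<Sum>x\<in>U. 2 * k)"
    by (rule sum_mono)
  moreover have "card D1 = (\<Sum>x\<in>U. card {y \<in> V. x \<in> V \<and> rel x y})"
    unfolding D1_def using U(1) assms(1) by (intro card_SigmaI) auto
  ultimately have D1: "card D1 \<le> 2 * k * (2 * k)"
    using U(2) by simp
  \<comment> \<open>Likewise each \<open>y\<close> is related to at most one vertex outside
    \<open>U\<close>.\<close>
  have "inj_on snd D2"
  proof (rule inj_onI)
    fix p q assume pq: "p \<in> D2" "q \<in> D2" "snd p = snd q"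
    obtain x y where p: "p = (x, y)" by fastforce
    obtain x' where q: "q = (x', y)" using p pq(3) by (metis prod.collapse snd_conv)
    have "x = x'"
      using pq p q hit[of x x'] rel_trans[of x y x'] rel_sym[of x' y] unfolding D2_def D_def by blast
    then show "p = q" using p q by simp
  qed
  moreover have "snd ` D2 \<subseteq> U"
    using hit unfolding D2_def D_def by fastforce
  ultimately have D2: "card D2 \<le> 2 * k"
    using U by (metis card_inj_on_le)
  have "D \<subseteq> D1 \<union> D2"
    unfolding D1_def D2_def D_def by auto
  moreover have "finite D1"
    using U(1) assms(1) unfolding D1_def by auto
  moreover have "finite D2"
    by (rule finite_subset[OF _ \<open>finite D\<close>]) (auto simp: D2_def)
  ultimately have "card D \<le> card D1 + card D2"
    by (meson card_Un_le card_mono finite_UnI le_trans)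
  moreover have "card {(x, y). x \<in> V \<and> y \<in> V \<and> x \<noteq> y \<and> {x, y} \<in> E} \<le> card D"
    by (rule card_mono[OF \<open>finite D\<close>]) (auto simp: D_def edge_rel)
  ultimately show ?thesis
    using D1 D2 by (simp add: algebra_simps)
qed

section \<open>The Cockayne--Lorimer theorem\<close>

text \<open>If every matching of colour \<open>i\<close> avoiding \<open>x\<close> has fewer than
  \<open>k i\<close> edges, deleting \<open>x\<close> and lowering \<open>k i\<close> reduces both
  sides by one; \<open>m\<close> stays fixed and still bounds all \<open>k i\<close>. Otherwise the
  edge count applies to every colour, and the colours together have too few edges.\<close>

theorem cockayne_lorimer_bound:
  fixes E :: "'i \<Rightarrow> 'a set set" and k :: "'i \<Rightarrow> nat"
  assumes "finite I" "finite V" "nsets V 2 \<subseteq> (\<Union>i\<in>I. E i)"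
    and "\<And>i M. i \<in> I \<Longrightarrow> M \<subseteq> E i \<inter> Pow V \<Longrightarrow> matching M \<Longrightarrow> card M \<le> k i"
    and "\<And>i. i \<in> I \<Longrightarrow> k i \<le> m"
  shows "card V < m + 2 + sum k I"
  using assms
proof (induction "sum k I" arbitrary: V k rule: less_induct)
  case less
  show ?case
  proof (cases "\<exists>i\<in>I. \<exists>x\<in>V. \<forall>M \<subseteq> E i \<inter> Pow (V - {x}). matching M \<longrightarrow> card M < k i")
    case True
    then obtain i x where ix: "i \<in> I" "x \<in> V"
      and small: "\<And>M. M \<subseteq> E i \<inter> Pow (V - {x}) \<Longrightarrow> matching M \<Longrightarrow> card M < k i"
      by blast
    \<comment> \<open>The empty matching counts, so the subtraction in \<open>k'\<close> is not
      truncated.\<close>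
    have "0 < k i"
      using small[of "{}"] matching_empty by simp
    define k' where "k' = k(i := k i - 1)"
    have sum: "sum k I = Suc (sum k' I)"
      using \<open>finite I\<close> ix(1) \<open>0 < k i\<close>
      by (simp add: sum.remove[of I i] k'_def)
    have "card (V - {x}) < m + 2 + sum k' I"
    proof (rule less.hyps)
      show "sum k' I < sum k I" using sum by simp
      show "finite I" "finite (V - {x})" using less.prems by simp_all
      have "nsets (V - {x}) 2 \<subseteq> nsets V 2" by (rule nsets_mono) blast
      then show "nsets (V - {x}) 2 \<subseteq> (\<Union>i\<in>I. E i)" using less.prems(3) by blast
      show "card M \<le> k' j" if "j \<in> I" "M \<subseteq> E j \<inter> Pow (V - {x})" "matching M" for j M
      proof (cases "j = i")
        case True
        then show ?thesis using small[of M] that by (simp add: k'_def)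
      next
        case False
        have "M \<subseteq> E j \<inter> Pow V" using that(2) by blast
        then show ?thesis using less.prems(4) that False by (simp add: k'_def)
      qed
      show "k' j \<le> m" if "j \<in> I" for j
        using less.prems(5)[OF that] less.prems(5)[OF ix(1)] by (auto simp: k'_def)
    qed
    then show ?thesis
      using sum ix(2) less.prems(2) by (simp add: card_Diff_singleton)
  next
    case False
    define P where "P i = {(x, y). x \<in> V \<and> y \<in> V \<and> x \<noteq> y \<and> {x, y} \<in> E i \<inter> Pow V}" for i
    have P: "card (P i) \<le> 2 * k i * (2 * m + 1)" if i: "i \<in> I" for i
    proof -
      have "card (P i) \<le> 2 * k i * (2 * k i + 1)"
        unfolding P_def
      proof (rule no_essential_vertex_edge_bound[OF less.prems(2)])
        show max: "card M \<le> k i" if "M \<subseteq> E i \<inter> Pow V" "matching M" for M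
          using less.prems(4) i that by blast
        fix x assume "x \<in> V"
        then obtain M where M: "M \<subseteq> E i \<inter> Pow (V - {x})" "matching M" "k i \<le> card M"
          using False i by (meson not_less)
        then have "M \<subseteq> E i \<inter> Pow V" "x \<notin> \<Union>M"
          by blast+
        moreover from this have "card M = k i"
          using max[of M] M by simp
        ultimately show "\<exists>M \<subseteq> E i \<inter> Pow V. matching M \<and> card M = k i \<and> x \<notin> \<Union>M"
          using M(2) by blast
      qed
      \<comment> \<open>Replacing one factor \<open>k i\<close> by \<open>m\<close> makes the bounds
        linear in \<open>k i\<close>, so that they add up to a multiple of
        \<open>sum k I\<close>.\<close>
      also have "\<dots> \<le> 2 * k i * (2 * m + 1)"
        using less.prems(5)[OF i] by simp
      finally show ?thesis .
    qed
    have fin: "finite (P i)" for i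
      by (rule finite_subset[of _ "V \<times> V"]) (auto simp: P_def less.prems(2))
    have "V \<times> V - Id_on V \<subseteq> (\<Union>i\<in>I. P i)"
    proof clarify
      fix x y assume xy: "x \<in> V" "y \<in> V" "(x, y) \<notin> Id_on V"
      then have "x \<noteq> y" by blast
      with xy have "{x, y} \<in> nsets V 2" by (simp add: nsets_def)
      then show "(x, y) \<in> (\<Union>i\<in>I. P i)"
        using less.prems(3) xy \<open>x \<noteq> y\<close> unfolding P_def by blast
    qed
    then have "card (V \<times> V - Id_on V) \<le> card (\<Union>i\<in>I. P i)"
      using fin less.prems(1) by (intro card_mono) auto
    also have "\<dots> \<le> (\<Sum>i\<in>I. card (P i))"
      using less.prems(1) by (rule card_UN_le)
    also have "\<dots> \<le> (\<Sum>i\<in>I. 2 * k i * (2 * m + 1))"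
      using P by (rule sum_mono)
    also have "\<dots> = 2 * sum k I * (2 * m + 1)"
      by (simp only: sum_distrib_left sum_distrib_right)
    finally have le: "card (V \<times> V - Id_on V) \<le> 2 * sum k I * (2 * m + 1)" .
    have "Id_on V = (\<lambda>x. (x, x)) ` V" by auto
    then have "card (Id_on V) = card V"
      by (simp add: card_image inj_on_def)
    moreover have "Id_on V \<subseteq> V \<times> V" by auto
    ultimately have "card (V \<times> V - Id_on V) = card V * card V - card V"
      using less.prems(2) by (simp add: card_Diff_subset card_cartesian_product finite_subset)
    with le have vle: "card V * card V - card V \<le> 2 * sum k I * (2 * m + 1)" by simp
    show ?thesis
    proof (rule ccontr)
      assume "\<not> ?thesis"
      then obtain d where d: "card V = m + 2 + sum k I + d"
        by (metis le_iff_add not_less)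
      define K where "K = sum k I"
      define v where "v = m + 1 + K + d"
      have "card V = v + 1" using d by (simp add: v_def K_def)
      then have "(v + 1) * v \<le> 2 * K * (2 * m + 1)"
        using vle by (simp add: K_def)
      moreover have "(m + K + 2) * (m + K + 1) \<le> (v + 1) * v"
        by (intro mult_mono) (simp_all add: v_def)
      ultimately have "(m + K + 2) * (m + K + 1) \<le> 2 * K * (2 * m + 1)" by linarith
      \<comment> \<open>The square of m - K is nonnegative. So the left side above, (m + K)^2 + 3(m
        + K) + 2, exceeds the right side, 4mK + 2K.\<close>
      moreover have "4 * (m * K) \<le> (m + K) * (m + K)"
      proof -
        have "0 \<le> (int m - int K) * (int m - int K)" by simp
        then have "int (4 * (m * K)) \<le> int ((m + K) * (m + K))"
          by (simp add: algebra_simps)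
        then show ?thesis by linarith
      qed
      ultimately show False by (simp add: algebra_simps)
    qed
  qed
qed

section \<open>Classical Ramsey numbers: a lower bound for R(3,k) and transfer to arbitrary
  sets\<close>

text \<open>The witness is the triangle-free graph on \<open>k + 1\<close> points whose only edges are 12 and 34.\<close>

lemma ramsey_number_3_ge:
  assumes "k \<ge> 3"
  shows "k + 2 \<le> ramsey_number 3 k"
proof (rule ccontr)
  define N where "N = ramsey_number 3 k"
  assume "\<not> ?thesis"
  then have N: "N \<le> k + 1" by (simp add: N_def)
  define red :: "nat set set" where "red = {{1, 2}, {3, 4}} \<inter> nsets {1..N} 2"
  define blue where "blue = nsets {1..N} 2 - red"
  have "red \<union> blue = nsets {1..N} 2" "red \<inter> blue = {}"
    unfolding red_def blue_def by blast+
  then consider (r) S where "S \<in> nsets {1..N} 3" "clique S red"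
    | (b) S where "S \<in> nsets {1..N} k" "clique S blue"
    using ramsey_number_arrows[of 3 k] unfolding ramsey_arrows_def N_def by blast
  then show False
  proof cases
    case r
    then have "card S = 3" by (simp add: nsets_def)
    then obtain x y z where "S = {x, y, z}" "x \<noteq> y" "y \<noteq> z" "x \<noteq> z"
      by (auto simp: card_3_iff)
    then have "{x, y} \<in> red" "{y, z} \<in> red" "{x, z} \<in> red"
      using r(2) by (auto simp: clique_def)
    then show False
      using \<open>x \<noteq> y\<close> \<open>y \<noteq> z\<close> \<open>x \<noteq> z\<close> unfolding red_def by (auto simp: doubleton_eq_iff)
  next
    case b
    then have S: "S \<subseteq> {1..N}" "card S = k" by (auto simp: nsets_def)
    \<comment> \<open>A blue clique omits an end of 12 and an end of 34, which leaves at most (k +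
      1) - 2 points.\<close>
    have miss: "x \<notin> S \<or> y \<notin> S" if "{x, y} \<in> {{1, 2}, {3, 4}}" "x \<noteq> y" for x y
    proof (rule ccontr)
      assume "\<not> ?thesis"
      then have "{x, y} \<in> blue"
        using b(2) that(2) unfolding clique_def by metis
      then show False
        using that unfolding blue_def red_def by blast
    qed
    obtain p q where pq: "p \<in> {1, 2}" "p \<notin> S" "q \<in> {3, 4}" "q \<notin> S"
      using miss[of 1 2] miss[of 3 4] by auto
    have "S \<subseteq> {1..k+1} - {p, q}"
      using S N pq by fastforce
    then have "card S \<le> card ({1..k+1} - {p, q})"
      by (intro card_mono) auto
    also have "\<dots> = k - 1"
    proof -
      \<comment> \<open>Here \<open>k \<ge> 3\<close> puts 1, 2, 3, 4 into
        \<open>{1..k+1}\<close>.\<close>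
      have "{p, q} \<subseteq> {1..k+1}" "card {p, q} = 2" using pq assms by auto
      then show ?thesis by (subst card_Diff_subset) auto
    qed
    finally show False using S assms by simp
  qed
qed

text \<open>A bijection with \<open>{1..N}\<close> pulls the colouring back from \<open>K\<close>.
  The classes may contain further edges, so the colouring of the whole Kneser graph can be used
  unrestricted.\<close>

lemma ramsey_number_transfer:
  fixes K :: "'a set"
  assumes "finite K" "card K = ramsey_number a b"
    and col: "\<And>e f. e \<in> K \<Longrightarrow> f \<in> K \<Longrightarrow> e \<noteq> f \<Longrightarrow> {e, f} \<in> red \<union> blue"
  obtains S where "S \<subseteq> K" "card S = a" "clique S red"
    | S where "S \<subseteq> K" "card S = b" "clique S blue"
proof -
  define N where "N = ramsey_number a b"
  obtain f where f: "bij_betw f {1..N} K"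
    using finite_same_card_bij[of "{1..N}" K] assms(1,2) by (auto simp: N_def)
  define red0 where "red0 = {p \<in> nsets {1..N} 2. f ` p \<in> red}"
  define blue0 where "blue0 = nsets {1..N} 2 - red0"
  have img: "f ` S \<subseteq> K" "card (f ` S) = card S" if "S \<subseteq> {1..N}" for S
    using f that unfolding bij_betw_def by (auto intro: card_image inj_on_subset)
  have cl: "clique (f ` S) C" if "clique S C0" "S \<subseteq> {1..N}"
    and "\<And>i j. i \<in> {1..N} \<Longrightarrow> j \<in> {1..N} \<Longrightarrow> f i \<noteq> f j \<Longrightarrow> {i, j} \<in> C0 \<Longrightarrow> {f i, f j} \<in> C" for S C C0
    unfolding clique_def
  proof clarify
    fix i j assume ij: "i \<in> S" "j \<in> S" "f i \<noteq> f j"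
    then have "{i, j} \<in> C0"
      using that(1) unfolding clique_def by metis
    then show "{f i, f j} \<in> C"
      using that(2,3) ij by blast
  qed
  have "red0 \<union> blue0 = nsets {1..N} 2" "red0 \<inter> blue0 = {}"
    unfolding red0_def blue0_def by blast+
  then consider (r) S where "S \<in> nsets {1..N} a" "clique S red0"
    | (b) S where "S \<in> nsets {1..N} b" "clique S blue0"
    using ramsey_number_arrows[of a b] unfolding ramsey_arrows_def N_def by blast
  then show thesis
  proof cases
    case r
    then have S: "S \<subseteq> {1..N}" "card S = a" by (auto simp: nsets_def)
    have "clique (f ` S) red"
      by (rule cl[OF r(2) S(1)]) (simp add: red0_def)
    then show thesis using that(1) img[OF S(1)] S(2) by blast
  next
    case b
    then have S: "S \<subseteq> {1..N}" "card S = b" by (auto simp: nsets_def)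
    have "clique (f ` S) blue"
    proof (rule cl[OF b(2) S(1)])
      fix i j assume ij: "i \<in> {1..N}" "j \<in> {1..N}" "f i \<noteq> f j" "{i, j} \<in> blue0"
      then have "{f i, f j} \<notin> red"
        unfolding blue0_def red0_def by auto
      moreover have "f i \<in> K" "f j \<in> K"
        using f ij by (auto simp: bij_betw_def)
      ultimately show "{f i, f j} \<in> blue"
        using col ij(3) by blast
    qed
    then show thesis using that(2) img[OF S(1)] S(2) by blast
  qed
qed

section \<open>Colourings of KG(n,2)\<close>

lemma kneser_edge_iff:
  "{A, B} \<in> kneser_edges n r \<longleftrightarrow>
    A \<in> nsets {1..n} r \<and> B \<in> nsets {1..n} r \<and> A \<noteq> B \<and> A \<inter> B = {}"
  unfolding kneser_edges_def kneser_vertices_def by (auto simp: doubleton_eq_iff)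

lemma clique_insert:
  "clique (insert x S) C \<longleftrightarrow> clique S C \<and> (\<forall>y\<in>S. y \<noteq> x \<longrightarrow> {x, y} \<in> C)"
  unfolding clique_def by (auto simp: insert_commute)

lemma kneser_arrows_3:
  fixes t N :: nat
  defines "N \<equiv> ramsey_number 3 (t - 2)"
  assumes "t \<le> N" "2 \<le> t"
  shows "ramsey_arrows (kneser_vertices (2 * N + 2 * t + 1) 2) (kneser_edges (2 * N + 2 * t + 1) 2) 3 t"
  unfolding ramsey_arrows_def kneser_vertices_def
proof (intro allI impI, rule ccontr)
  define n where "n = 2 * N + 2 * t + 1"
  fix red blue
  assume col: "red \<union> blue = kneser_edges (2 * N + 2 * t + 1) 2 \<and> red \<inter> blue = {}"
    and "\<not> ((\<exists>S\<in>nsets (nsets {1..2 * N + 2 * t + 1} 2) 3. clique S red) \<or>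
      (\<exists>S\<in>nsets (nsets {1..2 * N + 2 * t + 1} 2) t. clique S blue))"
  then have no_red: "\<not> clique S red" if "S \<subseteq> nsets {1..n} 2" "card S = 3" for S
    using that card_ge_0_finite[of S] unfolding nsets_def n_def by auto
  have no_blue: "\<not> clique S blue" if "S \<subseteq> nsets {1..n} 2" "card S = t" for S
    using \<open>\<not> (_ \<or> _)\<close> that card_ge_0_finite[of S] assms(3) unfolding nsets_def n_def by auto
  have edge: "{e, f} \<in> red \<or> {e, f} \<in> blue"
    if "e \<in> nsets {1..n} 2" "f \<in> nsets {1..n} 2" "e \<noteq> f" "e \<inter> f = {}" for e f
    using that kneser_edge_iff[of e f n 2] col unfolding n_def by blast
  have edgeD: "e \<in> nsets {1..n} 2" "f \<in> nsets {1..n} 2" "e \<noteq> f" "e \<inter> f = {}"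
    if "{e, f} \<in> red \<or> {e, f} \<in> blue" for e f
    using that kneser_edge_iff[of e f n 2] col unfolding n_def by blast+
  have triangle: False if "{e, f} \<in> red" "{f, g} \<in> red" "{e, g} \<in> red" for e f g
  proof -
    have "{e, f, g} \<subseteq> nsets {1..n} 2" "card {e, f, g} = 3" "clique {e, f, g} red"
      using edgeD[of e f] edgeD[of f g] edgeD[of e g] that
      by (auto simp: clique_def insert_commute)
    then show False using no_red by blast
  qed
  \<comment> \<open>Two disjoint edges that are both red to \<open>a\<close> cannot be red to each
    other, by \<open>triangle\<close>.\<close>
  have red_nbh: "clique M blue"
    if "matching M" "M \<subseteq> nsets {1..n} 2" "\<And>e. e \<in> M \<Longrightarrow> {a, e} \<in> red" for M a
    unfolding clique_def
  proof (intro ballI impI)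
    fix e f assume ef: "e \<in> M" "f \<in> M" "e \<noteq> f"
    then have "e \<inter> f = {}"
      using that(1) by (auto simp: matching_def pairwise_def disjnt_def)
    then have "{e, f} \<in> red \<or> {e, f} \<in> blue"
      using edge ef that(2) by blast
    then show "{e, f} \<in> blue"
      using triangle[of a e f] that(3) ef by blast
  qed
  obtain A B where AB: "{A, B} \<in> blue"
  proof -
    \<comment> \<open>Three pairwise disjoint edges cannot be pairwise red; \<open>2 \<le> t\<close>
      and \<open>t \<le> N\<close> give \<open>n \<ge> 9\<close>, room enough for them.\<close>
    have ns: "{1, 2} \<in> nsets {1..n} 2" "{3, 4} \<in> nsets {1..n} 2" "{5, 6} \<in> nsets {1..n} 2"
      using assms(2,3) by (auto simp: nsets_def n_def)
    have "{{1, 2}, {3, 4}} \<in> red \<union> blue" "{{3, 4}, {5, 6}} \<in> red \<union> blue" "{{1, 2}, {5, 6}} \<in> red \<union> blue"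
      using edge[OF ns(1,2)] edge[OF ns(2,3)] edge[OF ns(1,3)] by (auto simp: doubleton_eq_iff)
    then show thesis using triangle that by blast
  qed
  note A = edgeD[OF disjI2[OF AB]]
  define W where "W = {1..n} - (A \<union> B)"
  have "card (A \<union> B) = 4" "A \<union> B \<subseteq> {1..n}" "finite (A \<union> B)"
    using A by (auto simp: nsets_def card_Un_disjoint)
  then have cardW: "card W = 2 * N + 2 * t - 3"
    unfolding W_def by (simp add: card_Diff_subset n_def)
  have W: "e \<in> nsets {1..n} 2" "{A, e} \<in> red \<or> {A, e} \<in> blue" "{B, e} \<in> red \<or> {B, e} \<in> blue"
    if "card e = 2" "e \<subseteq> W" for e
  proof -
    show e: "e \<in> nsets {1..n} 2"
      using that card_ge_0_finite[of e] by (auto simp: nsets_def W_def)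
    have "e \<noteq> {}" using that by auto
    then have "A \<noteq> e" "A \<inter> e = {}" "B \<noteq> e" "B \<inter> e = {}"
      using that(2) unfolding W_def by blast+
    then show "{A, e} \<in> red \<or> {A, e} \<in> blue" "{B, e} \<in> red \<or> {B, e} \<in> blue"
      using edge e A by blast+
  qed
  define E :: "nat \<Rightarrow> nat set set" where "E = (\<lambda>i.
    if i = 0 then {e. {A, e} \<in> red}
    else if i = 1 then {e. {A, e} \<in> blue \<and> {B, e} \<in> red}
    else {e. {A, e} \<in> blue \<and> {B, e} \<in> blue})"
  \<comment> \<open>Each value is one less than the matching size wanted: t, t - 1 and N. As
    \<open>t \<le> N\<close>, the largest is \<open>N - 1\<close>, and (N - 1) + 2 + (t - 1) + (t -
    2) + (N - 1) is exactly \<open>card W\<close>.\<close>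
  define k :: "nat \<Rightarrow> nat" where "k = (\<lambda>i. if i = 0 then t - 1 else if i = 1 then t - 2 else N - 1)"
  have "\<exists>i\<in>{0, 1, 2}. \<exists>M \<subseteq> E i \<inter> Pow W. matching M \<and> card M = Suc (k i)"
  proof (rule ccontr)
    assume none: "\<not> ?thesis"
    have "card W < (N - 1) + 2 + sum k {0, 1, 2}"
    proof (rule cockayne_lorimer_bound)
      show "finite {0, 1, 2 :: nat}" "finite W" by (simp_all add: W_def)
      show "nsets W 2 \<subseteq> (\<Union>i\<in>{0, 1, 2}. E i)"
        using W by (auto simp: nsets_def E_def)
      show "k i \<le> N - 1" if "i \<in> {0, 1, 2}" for i
        using assms(2) by (auto simp: k_def)
      fix i M assume i: "i \<in> {0, 1, 2 :: nat}" and M: "M \<subseteq> E i \<inter> Pow W" "matching M"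
      show "card M \<le> k i"
      proof (rule ccontr)
        assume "\<not> ?thesis"
        then have "Suc (k i) \<le> card M" by simp
        \<comment> \<open>Trimmed to the exact size, since \<open>no_blue\<close> concerns cliques
          with exactly \<open>t\<close> vertices.\<close>
        then obtain M' where M': "M' \<subseteq> M" "card M' = Suc (k i)"
          by (rule obtain_subset_with_card_n)
        have "M' \<subseteq> E i \<inter> Pow W"
          using M'(1) M(1) by (rule subset_trans)
        moreover have "matching M'"
          using M(2) M'(1) by (rule matching_subset)
        ultimately show False
          using none i M'(2) by metis
      qed
    qed
    then show False
      using cardW assms(2,3) by (simp add: k_def)
  qed
  then obtain i M where i: "i \<in> {0, 1, 2}" and M: "M \<subseteq> E i" "M \<subseteq> Pow W" "matching M" "card M = Suc (k i)"
    by blast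
  have fin: "finite M" using M(3) by (simp add: matching_def)
  have Mn: "M \<subseteq> nsets {1..n} 2"
    using M(2,3) W(1) unfolding matching_def by blast
  consider "i = 0" | "i = 1" | "i = 2" using i by blast
  then show False
  proof cases
    assume "i = 0"
    then have "card M = t" "\<And>e. e \<in> M \<Longrightarrow> {A, e} \<in> red"
      using M(1,4) assms(3) by (auto simp: k_def E_def)
    then show False
      using no_blue[OF Mn] red_nbh[OF M(3) Mn] by blast
  next
    assume "i = 1"
    then have M1: "card M = t - 1" "\<And>e. e \<in> M \<Longrightarrow> {A, e} \<in> blue" "\<And>e. e \<in> M \<Longrightarrow> {B, e} \<in> red"
      using M(1,4) assms(3) by (auto simp: k_def E_def)
    \<comment> \<open>\<open>A\<close> in \<open>M\<close> would make \<open>{A, A}\<close> an edge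
      of the Kneser graph, but its edges have distinct ends.\<close>
    have "A \<notin> M"
      using M1(2) edgeD(3)[of A A] by blast
    then have "card (insert A M) = t" "insert A M \<subseteq> nsets {1..n} 2"
      using M1(1) fin Mn A assms(3) by auto
    moreover have "clique (insert A M) blue"
      using red_nbh[OF M(3) Mn M1(3)] M1(2) by (simp add: clique_insert)
    ultimately show False
      using no_blue by blast
  next
    assume "i = 2"
    then have M2: "card M = N" "\<And>e. e \<in> M \<Longrightarrow> {A, e} \<in> blue" "\<And>e. e \<in> M \<Longrightarrow> {B, e} \<in> blue"
      using M(1,4) assms(2,3) by (auto simp: k_def E_def)
    \<comment> \<open>The members of \<open>M\<close> are pairwise disjoint, hence form a
      two-coloured complete graph on N = R(3,t-2) vertices.\<close>
    have "{e, f} \<in> red \<union> blue" if "e \<in> M" "f \<in> M" "e \<noteq> f" for e f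
      using edge[of e f] that Mn M(3) unfolding matching_def pairwise_def disjnt_def by blast
    then show False
    proof (rule ramsey_number_transfer[OF fin M2(1)[unfolded N_def]])
      fix S assume "S \<subseteq> M" "card S = 3" "clique S red"
      then show False using no_red[of S] Mn by blast
    next
      fix S assume S: "S \<subseteq> M" "card S = t - 2" "clique S blue"
      have "A \<notin> M" "B \<notin> M"
        using M2(2,3) edgeD(3)[of A A] edgeD(3)[of B B] by blast+
      then have "card (insert A (insert B S)) = t"
        using S A(3) finite_subset[OF S(1) fin] assms(3) by (auto simp: card_insert_if)
      moreover have "insert A (insert B S) \<subseteq> nsets {1..n} 2"
        using A Mn S(1) by blast
      moreover have "clique (insert A (insert B S)) blue"
        using S M2 AB by (auto simp: clique_insert)
      ultimately show False
        using no_blue by blast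
    qed
  qed
qed

theorem theorem1p9:
  fixes t :: nat
  assumes "t \<ge> 5"
  shows "kneser_ramsey_number 2 3 t \<le> 2 * ramsey_number 3 (t - 2) + 2 * t + 1"
proof -
  \<comment> \<open>\<open>t \<ge> 5\<close> makes the lower bound available at k = t - 2, where it
    reads k + 2 = t.\<close>
  have "t \<le> ramsey_number 3 (t - 2)"
    using ramsey_number_3_ge[of "t - 2"] assms by linarith
  then show ?thesis
    unfolding kneser_ramsey_number_def using assms by (intro Least_le kneser_arrows_3) simp_all
qed

end
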